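(* Let $m,n$ be positive integers, $a,b$ non-negative integers with $a+b=n$ and $a$ even, and $x,y$ complex numbers with $ax+by=0$. Define \[ R_{1,4}(x,y;m,n;\tau)= mn\, q^{\frac{a}{4}}\sum_{\substack{r_1,\ldots,r_a,s_1,\ldots,s_b\in\mathbb{Z}\\ 2(r_1+\cdots+r_a+s_1+\cdots+s_b)+a=0}}q^{r_1^2+\cdots+r_a^2+s_1^2+\cdots+s_b^2+r_1+\cdots+r_a}e^{i(2(r_1+\cdots+r_a)x+2(s_1+\cdots+s_b)y+ax)}. \] Let $S(z)=\sum_{k=0}^{mn-1}\vartheta_1^{a}\!\left(z+x+\tfrac{k\pi}{mn}\Big|\tau\right)\vartheta_4^{b}\!\left(z+y+\tfrac{k\pi}{mn}\Big|\tau\right)$. Then for all $z\in\mathbb{C}$: if $mn$ is even, $S(z)=R_{1,4}(x,y;m,n;\tau)\,\vartheta_3(mnz\,|\,m^2n\tau)$; if $mn$ is odd, $S(z)=R_{1,4}(x,y;m,n;\tau)\,\vartheta_4(mnz\,|\,m^2n\tau)$.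
   Context: Throughout, $\tau\in\mathbb{C}$ with $\Im(\tau)>0$, $q=e^{\pi i\tau}$, and $q^{\alpha}$ means $e^{\pi i\alpha\tau}$ for real $\alpha$. The Jacobi theta functions are $\vartheta_1(z|\tau)=-iq^{1/4}\sum_{n\in\mathbb{Z}}(-1)^nq^{n(n+1)}e^{(2n+1)iz}$, $\vartheta_3(z|\tau)=\sum_{n\in\mathbb{Z}}q^{n^2}e^{2niz}$, $\vartheta_4(z|\tau)=\sum_{n\in\mathbb{Z}}(-1)^nq^{n^2}e^{2niz}$; and $\vartheta_j(z|m^2n\tau)$ denotes the same function with $\tau$ replaced by $m^2n\tau$. A zeroth power equals $1$. *)

theory Defs
  imports "HOL-Analysis.Analysis"
begin

text \<open>
  With the nome \<open>q = exp (\<pi> \<i> \<tau>)\<close>, the power \<open>q\<^sup>\<alpha>\<close> for real \<open>\<alpha>\<close> always means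
  \<open>exp (\<pi> \<i> \<alpha> \<tau>)\<close>; it is not \<open>q powr \<alpha>\<close>, which depends on \<open>q\<close> only and hence takes
  the principal branch.
\<close>

definition qpow :: "complex \<Rightarrow> real \<Rightarrow> complex" where
  "qpow \<tau> \<alpha> = exp (of_real pi * \<i> * of_real \<alpha> * \<tau>)"

definition theta1 :: "complex \<Rightarrow> complex \<Rightarrow> complex" where
  "theta1 z \<tau> = - \<i> * qpow \<tau> (1/4) *
     (\<Sum>\<^sub>\<infinity>n::int. (-1) powi n * qpow \<tau> (of_int (n * (n + 1))) * exp (of_int (2 * n + 1) * \<i> * z))"

definition theta3 :: "complex \<Rightarrow> complex \<Rightarrow> complex" where
  "theta3 z \<tau> = (\<Sum>\<^sub>\<infinity>n::int. qpow \<tau> (of_int (n\<^sup>2)) * exp (2 * of_int n * \<i> * z))"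

definition theta4 :: "complex \<Rightarrow> complex \<Rightarrow> complex" where
  "theta4 z \<tau> = (\<Sum>\<^sub>\<infinity>n::int. (-1) powi n * qpow \<tau> (of_int (n\<^sup>2)) * exp (2 * of_int n * \<i> * z))"

text \<open>
  The integer tuples \<open>(r\<^sub>1, \<dots>, r\<^sub>a)\<close> and \<open>(s\<^sub>1, \<dots>, s\<^sub>b)\<close> are extensional functions on
  \<open>{1..a}\<close> and \<open>{1..b}\<close>, so that each tuple is counted exactly once (and there is exactly
  one empty tuple).
\<close>

definition R14_index :: "nat \<Rightarrow> nat \<Rightarrow> ((nat \<Rightarrow> int) \<times> (nat \<Rightarrow> int)) set" where
  "R14_index a b =
     {(r, s). r \<in> {1..a} \<rightarrow>\<^sub>E UNIV \<and> s \<in> {1..b} \<rightarrow>\<^sub>E UNIV \<and>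
              2 * ((\<Sum>j=1..a. r j) + (\<Sum>j=1..b. s j)) + int a = 0}"

definition R14 ::
  "nat \<Rightarrow> nat \<Rightarrow> complex \<Rightarrow> complex \<Rightarrow> nat \<Rightarrow> nat \<Rightarrow> complex \<Rightarrow> complex" where
  "R14 a b x y m n \<tau> =
     of_nat (m * n) * qpow \<tau> (of_nat a / 4) *
     (\<Sum>\<^sub>\<infinity>(r, s)\<in>R14_index a b.
        qpow \<tau> (of_int ((\<Sum>j=1..a. (r j)\<^sup>2) + (\<Sum>j=1..b. (s j)\<^sup>2) + (\<Sum>j=1..a. r j))) *
        exp (\<i> * (2 * of_int (\<Sum>j=1..a. r j) * x + 2 * of_int (\<Sum>j=1..b. s j) * y + of_nat a * x)))"

definition S14 ::
  "nat \<Rightarrow> nat \<Rightarrow> complex \<Rightarrow> complex \<Rightarrow> nat \<Rightarrow> nat \<Rightarrow> complex \<Rightarrow> complex \<Rightarrow> complex" where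
  "S14 a b x y m n \<tau> z =
     (\<Sum>k=0..<m * n.
        theta1 (z + x + of_nat k * of_real pi / of_nat (m * n)) \<tau> ^ a *
        theta4 (z + y + of_nat k * of_real pi / of_nat (m * n)) \<tau> ^ b)"

end

theory Submission
  imports Defs
begin

text \<open>
  Multiplying out the theta series turns each summand of \<open>S14\<close> into an absolutely convergent sum
  over integer tuples \<open>(r, s)\<close> in which the argument \<open>z\<close> only enters through \<open>exp (2 h \<i> z)\<close>, where
  \<open>h = \<Sum>r + \<Sum>s + a/2\<close>. Summing over the translates \<open>z + k\<pi>/(mn)\<close> is a root-of-unity filter that
  keeps exactly the tuples with \<open>h = mnp\<close> for some integer \<open>p\<close>. Such a tuple is uniquely a tuple with
  \<open>h = 0\<close> all of whose entries are shifted by \<open>mp\<close>. Because of \<open>h = 0\<close> and \<open>ax + by = 0\<close> all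
  cross terms vanish, so the shift multiplies a term by \<open>q\<close> to the power \<open>m\<^sup>2np\<^sup>2\<close> and the sum factors.
\<close>

text \<open>The two library notions of absolute summability share one notation; this leaves the one
  from \<^theory>\<open>HOL-Analysis.Infinite_Sum\<close>.\<close>

no_notation Infinite_Set_Sum.abs_summable_on (infix \<open>abs'_summable'_on\<close> 50)

section \<open>Analytic preliminaries: Gaussian series over integers and tuples, products,
  root-of-unity sums\<close>

lemma summable_on_geometric_abs_int:
  fixes c :: real assumes "0 \<le> c" "c < 1"
  shows "(\<lambda>n::int. c ^ nat \<bar>n\<bar>) summable_on UNIV"
proof -
  have nat: "(\<lambda>n::nat. c ^ n) summable_on UNIV"
    using assms by (subst summable_on_UNIV_nonneg_real_iff) (auto intro: summable_geometric)
  have U: "(UNIV :: int set) = range int \<union> range (\<lambda>n. - int n)"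
    by (auto simp: image_iff) (metis int_cases2)
  show ?thesis unfolding U
    using nat by (intro summable_on_union) (auto simp: summable_on_reindex inj_on_def o_def)
qed

text \<open>The quadratic part dominates: completing the square bounds the real part of the exponent
  by a constant minus |n|, so a two-sided geometric series is a majorant.\<close>

lemma abs_summable_exp_quadratic_int:
  fixes \<alpha> \<beta> \<gamma> :: complex
  assumes "Re \<alpha> < 0"
  shows "(\<lambda>n::int. exp (\<alpha> * of_int n ^ 2 + \<beta> * of_int n + \<gamma>)) abs_summable_on UNIV"
proof (rule Infinite_Sum.abs_summable_on_comparison_test')
  \<comment> \<open>The first summand is the maximum over real t of Re \<alpha> * t^2 + (|Re
    \<beta>| + 1) * t. The extra 1 in the linear coefficient is what leaves the decay exp
    (-t).\<close>
  define d where "d = (\<bar>Re \<beta>\<bar> + 1) ^ 2 / (4 * - Re \<alpha>) + Re \<gamma>"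
  show "(\<lambda>n::int. exp d * exp (-1) ^ nat \<bar>n\<bar>) summable_on UNIV"
    by (intro summable_on_cmult_right summable_on_geometric_abs_int) auto
  fix n :: int
  define t where "t = \<bar>real_of_int n\<bar>"
  have "0 \<le> (2 * Re \<alpha> * t + (\<bar>Re \<beta>\<bar> + 1)) ^ 2" by simp
  hence "Re \<alpha> * t ^ 2 + (\<bar>Re \<beta>\<bar> + 1) * t \<le> (\<bar>Re \<beta>\<bar> + 1) ^ 2 / (4 * - Re \<alpha>)"
    using assms by (simp add: field_simps power2_eq_square)
  moreover have "Re \<beta> * of_int n \<le> \<bar>Re \<beta>\<bar> * t"
    unfolding t_def by (metis abs_ge_self abs_mult)
  ultimately have "Re (\<alpha> * of_int n ^ 2 + \<beta> * of_int n + \<gamma>) \<le> d - t"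
    unfolding d_def t_def by (simp add: power2_eq_square algebra_simps)
  moreover have "exp (-1) ^ nat \<bar>n\<bar> = exp (- t)"
    by (simp add: t_def flip: exp_of_nat_mult)
  ultimately show "norm (exp (\<alpha> * of_int n ^ 2 + \<beta> * of_int n + \<gamma>)) \<le> exp d * exp (-1) ^ nat \<bar>n\<bar>"
    by (simp flip: exp_add)
qed

lemma
  fixes f :: "'a \<Rightarrow> 'c :: {banach, real_normed_field}"
  assumes f: "f abs_summable_on A" and g: "g abs_summable_on B"
  shows abs_summable_on_Times_mult: "(\<lambda>(x, y). f x * g y) abs_summable_on A \<times> B"
    and infsum_Times_mult: "(\<Sum>\<^sub>\<infinity>(x, y)\<in>A \<times> B. f x * g y) = infsum f A * infsum g B"
proof -
  show *: "(\<lambda>(x, y). f x * g y) abs_summable_on A \<times> B"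
    unfolding Infinite_Sum.abs_summable_on_Sigma_iff using f g
    by (auto simp: norm_mult infsum_cmult_right abs_mult infsum_nonneg
        intro!: summable_on_cmult_right summable_on_cmult_left)
  show "(\<Sum>\<^sub>\<infinity>(x, y)\<in>A \<times> B. f x * g y) = infsum f A * infsum g B"
    using infsum_Sigma'_banach[of "\<lambda>x y. f x * g y" A "\<lambda>_. B"] abs_summable_summable[OF *]
      abs_summable_summable[OF f] abs_summable_summable[OF g]
    by (simp add: infsum_cmult_right infsum_cmult_left)
qed

text \<open>The exponent is a sum over coordinates, each contributing one \<gamma>, so
  \<open>E\<close> is a product of one-variable terms. This turns powers of a theta series into sums
  over tuples.\<close>

lemma
  fixes \<alpha> \<beta> \<gamma> :: complex and a :: nat
  assumes \<alpha>: "Re \<alpha> < 0"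
  defines "E \<equiv> \<lambda>r. exp (\<alpha> * of_int (\<Sum>j=1..a. (r j)\<^sup>2) + \<beta> * of_int (\<Sum>j=1..a. r j) + of_nat a * \<gamma>)"
  shows abs_summable_exp_quadratic_tuple: "E abs_summable_on ({1..a} \<rightarrow>\<^sub>E (UNIV :: int set))"
    and infsum_exp_quadratic_tuple:
      "infsum E ({1..a} \<rightarrow>\<^sub>E UNIV) = (\<Sum>\<^sub>\<infinity>n::int. exp (\<alpha> * of_int n ^ 2 + \<beta> * of_int n + \<gamma>)) ^ a"
proof -
  define f where "f = (\<lambda>n::int. exp (\<alpha> * of_int n ^ 2 + \<beta> * of_int n + \<gamma>))"
  have f: "f abs_summable_on UNIV"
    unfolding f_def by (rule abs_summable_exp_quadratic_int) fact
  have E: "E = (\<lambda>r. \<Prod>j=1..a. f (r j))"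
    by (simp add: E_def f_def sum.distrib sum_distrib_left fun_eq_iff flip: exp_sum)
  show "E abs_summable_on ({1..a} \<rightarrow>\<^sub>E UNIV)"
    unfolding E abs_summable_equivalent
    using f by (intro Infinite_Set_Sum.abs_summable_on_prod_PiE) (auto simp: abs_summable_equivalent)
  have "infsum E ({1..a} \<rightarrow>\<^sub>E UNIV) = (\<Prod>j=1..a. infsum f UNIV)"
    unfolding E using f by (intro infsum_prod_PiE_abs) auto
  thus "infsum E ({1..a} \<rightarrow>\<^sub>E UNIV) = (\<Sum>\<^sub>\<infinity>n::int. exp (\<alpha> * of_int n ^ 2 + \<beta> * of_int n + \<gamma>)) ^ a"
    by (simp add: f_def)
qed

text \<open>The summands are the powers of an N-th root of unity \<open>w\<close>. It is 1 exactly
  when N divides M; otherwise the geometric sum vanishes because w^N = 1.\<close>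

lemma sum_exp_multiples:
  fixes M :: int and N :: nat
  assumes "N > 0"
  shows "(\<Sum>k<N. exp (2 * of_int M * \<i> * (of_nat k * of_real pi / of_nat N))) =
    (if int N dvd M then of_nat N else 0 :: complex)"
proof -
  define w where "w = exp (2 * of_int M * \<i> * of_real pi / of_nat N)"
  have w: "exp (2 * of_int M * \<i> * (of_nat k * of_real pi / of_nat N)) = w ^ k" for k
    by (simp add: w_def mult_ac flip: exp_of_nat_mult)
  have "w ^ N = exp (2 * of_int M * \<i> * of_real pi)"
    using assms by (simp add: w_def flip: exp_of_nat_mult)
  hence wN: "w ^ N = 1"
    using exp_eq_1 by auto
  have "w = 1 \<longleftrightarrow> int N dvd M"
  proof -
    have "w = 1 \<longleftrightarrow> (\<exists>n. real_of_int M = of_int (int N * n))"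
      using assms by (auto simp: w_def exp_eq_1 field_simps)
    thus ?thesis by (auto simp only: of_int_eq_iff dvd_def)
  qed
  thus ?thesis unfolding w using wN by (auto simp: sum_gp_strict)
qed

section \<open>Theta functions as series of Gaussian exponentials\<close>

lemma minus_one_powi_eq_exp: "(-1) powi n = exp (\<i> * of_real pi * of_int n)"
  by (metis exp_pi_i' exp_power_int mult.commute)

text \<open>Writing -i as exp (-i pi/2) and the sign as exp (i pi n) absorbs all prefactors into one
  quadratic exponent, the shape required by the tuple lemmas.\<close>

lemma theta1_exp: "theta1 z \<tau> = (\<Sum>\<^sub>\<infinity>n::int. exp (of_real pi * \<i> * \<tau> * of_int n ^ 2
   + (of_real pi * \<i> * \<tau> + \<i> * of_real pi + 2 * \<i> * z) * of_int n
   + (of_real pi * \<i> * \<tau> / 4 - \<i> * of_real pi / 2 + \<i> * z)))"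
proof -
  have "exp (- (\<i> * of_real pi / 2)) = - \<i>"
    by (simp add: complex_eq_iff Re_exp Im_exp)
  then have "theta1 z \<tau> = exp (- (\<i> * of_real pi / 2)) * qpow \<tau> (1/4) *
     (\<Sum>\<^sub>\<infinity>n::int. (-1) powi n * qpow \<tau> (of_int (n * (n + 1))) * exp (of_int (2 * n + 1) * \<i> * z))"
    by (simp only: theta1_def)
  also have "\<dots> = (\<Sum>\<^sub>\<infinity>n::int. exp (- (\<i> * of_real pi / 2)) * qpow \<tau> (1/4) *
     ((-1) powi n * qpow \<tau> (of_int (n * (n + 1))) * exp (of_int (2 * n + 1) * \<i> * z)))"
    by (rule infsum_cmult_right'[symmetric])
  finally show ?thesis
    unfolding qpow_def minus_one_powi_eq_exp exp_add[symmetric] mult.assoc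
    by (simp add: algebra_simps power2_eq_square)
qed

text \<open>The trailing \<open>+ 0\<close> is the constant \<gamma> = 0 of the general quadratic
  exponent.\<close>

lemma theta4_exp: "theta4 z \<tau> = (\<Sum>\<^sub>\<infinity>n::int. exp (of_real pi * \<i> * \<tau> * of_int n ^ 2
   + (\<i> * of_real pi + 2 * \<i> * z) * of_int n + 0))"
  unfolding theta4_def qpow_def minus_one_powi_eq_exp
  by (simp add: algebra_simps flip: exp_add)

section \<open>Shifting integer tuples\<close>

lemma sum_shift:
  fixes r :: "nat \<Rightarrow> int"
  shows "(\<Sum>j=1..a. restrict (\<lambda>j. r j + c) {1..a} j) = (\<Sum>j=1..a. r j) + int a * c"
    and "(\<Sum>j=1..a. (restrict (\<lambda>j. r j + c) {1..a} j)\<^sup>2) =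
      (\<Sum>j=1..a. (r j)\<^sup>2) + 2 * c * (\<Sum>j=1..a. r j) + int a * c\<^sup>2"
  by (simp_all add: sum.distrib power2_sum sum_distrib_left sum_distrib_right mult_ac)

text \<open>\<open>restrict\<close> keeps the shifted tuples extensional, hence inside
  \<open>tuples a b\<close>.\<close>

definition shift_pair ::
  "nat \<Rightarrow> nat \<Rightarrow> int \<Rightarrow> (nat \<Rightarrow> int) \<times> (nat \<Rightarrow> int) \<Rightarrow> (nat \<Rightarrow> int) \<times> (nat \<Rightarrow> int)" where
  "shift_pair a b c = (\<lambda>(r, s). (restrict (\<lambda>j. r j + c) {1..a}, restrict (\<lambda>j. s j + c) {1..b}))"

text \<open>For even a this is the h of the overview: 2h = 2(sum r + sum s) + a is the frequency of
  z in the product term. The division by 2 is exact only for even a.\<close>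

definition half_weight :: "nat \<Rightarrow> nat \<Rightarrow> (nat \<Rightarrow> int) \<times> (nat \<Rightarrow> int) \<Rightarrow> int" where
  "half_weight a b = (\<lambda>(r, s). (\<Sum>j=1..a. r j) + (\<Sum>j=1..b. s j) + int (a div 2))"

abbreviation tuples :: "nat \<Rightarrow> nat \<Rightarrow> ((nat \<Rightarrow> int) \<times> (nat \<Rightarrow> int)) set" where
  "tuples a b \<equiv> ({1..a} \<rightarrow>\<^sub>E UNIV) \<times> ({1..b} \<rightarrow>\<^sub>E UNIV)"

lemma half_weight_shift: "half_weight a b (shift_pair a b c u) = half_weight a b u + int (a + b) * c"
  by (cases u) (simp add: half_weight_def shift_pair_def sum.distrib algebra_simps)

lemma shift_pair_in_tuples: "shift_pair a b c u \<in> tuples a b"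
  by (cases u) (auto simp: shift_pair_def)

lemma shift_pair_shift_pair:
  "u \<in> tuples a b \<Longrightarrow> shift_pair a b c (shift_pair a b d u) = shift_pair a b (c + d) u"
  by (cases u) (auto simp: shift_pair_def fun_eq_iff)

lemma shift_pair_0: "u \<in> tuples a b \<Longrightarrow> shift_pair a b 0 u = u"
  by (cases u) (auto simp: shift_pair_def PiE_iff extensional_restrict)

lemma R14_index_altdef: "even a \<Longrightarrow> R14_index a b = {u \<in> tuples a b. half_weight a b u = 0}"
  by (auto simp: R14_index_def half_weight_def elim!: evenE)

text \<open>Shifting by mp raises h by m(a + b)p. Hence the quotient of h by m(a + b) recovers p,
  and shifting back by mp recovers the tuple with h = 0.\<close>

lemma bij_betw_shift_pair:
  assumes "even a" "m > 0" "a + b > 0"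
  shows "bij_betw (\<lambda>(p, u). shift_pair a b (int m * p) u) (UNIV \<times> R14_index a b)
           {u \<in> tuples a b. int (m * (a + b)) dvd half_weight a b u}"
proof (rule bij_betw_byWitness)
  define N where "N = int (m * (a + b))"
  have N: "N \<noteq> 0"
    using assms by (auto simp: N_def)
  have hw: "half_weight a b (shift_pair a b (int m * p) u) = half_weight a b u + N * p"
           "half_weight a b (shift_pair a b (- (int m * p)) u) = half_weight a b u - N * p" for p u
    by (simp_all add: half_weight_shift N_def algebra_simps)
  let ?g = "\<lambda>u. (half_weight a b u div N, shift_pair a b (- (int m * (half_weight a b u div N))) u)"
  show "\<forall>v\<in>UNIV \<times> R14_index a b. ?g ((\<lambda>(p, u). shift_pair a b (int m * p) u) v) = v"
    using N by (auto simp: R14_index_altdef[OF assms(1)] hw shift_pair_shift_pair shift_pair_0)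
  show "\<forall>u\<in>{u \<in> tuples a b. int (m * (a + b)) dvd half_weight a b u}.
          (\<lambda>(p, u). shift_pair a b (int m * p) u) (?g u) = u"
    by (auto simp: shift_pair_shift_pair shift_pair_0)
  show "(\<lambda>(p, u). shift_pair a b (int m * p) u) ` (UNIV \<times> R14_index a b)
          \<subseteq> {u \<in> tuples a b. int (m * (a + b)) dvd half_weight a b u}"
    unfolding N_def[symmetric] R14_index_altdef[OF assms(1)]
  proof (rule image_subsetI)
    fix v assume "v \<in> (UNIV :: int set) \<times> {u \<in> tuples a b. half_weight a b u = 0}"
    thus "(\<lambda>(p, u). shift_pair a b (int m * p) u) v \<in> {u \<in> tuples a b. N dvd half_weight a b u}"
      using shift_pair_in_tuples[of a b "int m * fst v" "snd v"]
      by (simp add: case_prod_beta hw mem_Times_iff)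
  qed
  show "?g ` {u \<in> tuples a b. int (m * (a + b)) dvd half_weight a b u} \<subseteq> UNIV \<times> R14_index a b"
    unfolding N_def[symmetric] R14_index_altdef[OF assms(1)]
  proof (rule image_subsetI)
    fix u assume "u \<in> {u \<in> tuples a b. N dvd half_weight a b u}"
    thus "?g u \<in> UNIV \<times> {u \<in> tuples a b. half_weight a b u = 0}"
      using shift_pair_in_tuples[of a b "- (int m * (half_weight a b u div N))" u] by (simp add: hw)
  qed
qed

section \<open>Expansion of the theta product and behaviour of its terms under shifts\<close>

definition R14_term ::
  "nat \<Rightarrow> nat \<Rightarrow> complex \<Rightarrow> complex \<Rightarrow> complex \<Rightarrow> (nat \<Rightarrow> int) \<times> (nat \<Rightarrow> int) \<Rightarrow> complex" where
  "R14_term a b x y \<tau> = (\<lambda>(r, s).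
     qpow \<tau> (of_int ((\<Sum>j=1..a. (r j)\<^sup>2) + (\<Sum>j=1..b. (s j)\<^sup>2) + (\<Sum>j=1..a. r j))) *
     exp (\<i> * (2 * of_int (\<Sum>j=1..a. r j) * x + 2 * of_int (\<Sum>j=1..b. s j) * y + of_nat a * x)))"

text \<open>All dependence on w sits in the factor with frequency 2h. The pi beside 2w collects the
  signs: for even a, (-i)^a = (-1)^(a/2), which together with the signs of both series gives exp (i
  pi h).\<close>

lemma
  fixes x y \<tau> w :: complex and a b :: nat
  assumes \<tau>: "Im \<tau> > 0" and "even a"
  defines "F \<equiv> \<lambda>w u. qpow \<tau> (of_nat a / 4) * R14_term a b x y \<tau> u *
                     exp (of_int (half_weight a b u) * \<i> * (of_real pi + 2 * w))"
  shows abs_summable_theta_product: "F w abs_summable_on tuples a b"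
    and theta_product_eq_infsum:
      "theta1 (w + x) \<tau> ^ a * theta4 (w + y) \<tau> ^ b = infsum (F w) (tuples a b)"
proof -
  define \<alpha> where "\<alpha> = of_real pi * \<i> * \<tau>"
  have \<alpha>: "Re \<alpha> < 0" using \<tau> by (simp add: \<alpha>_def)
  define \<beta>\<^sub>1 where "\<beta>\<^sub>1 = \<alpha> + \<i> * of_real pi + 2 * \<i> * (w + x)"
  define \<gamma>\<^sub>1 where "\<gamma>\<^sub>1 = \<alpha> / 4 - \<i> * of_real pi / 2 + \<i> * (w + x)"
  define \<beta>\<^sub>4 where "\<beta>\<^sub>4 = \<i> * of_real pi + 2 * \<i> * (w + y)"
  define E where "E = (\<lambda>\<beta> \<gamma> a r.
      exp (\<alpha> * of_int (\<Sum>j=1..a. (r j)\<^sup>2) + \<beta> * of_int (\<Sum>j=1..a. r j) + of_nat a * \<gamma> :: complex))"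
  obtain c where c: "a = 2 * c" using \<open>even a\<close> by blast
  have F: "F w = (\<lambda>(r, s). E \<beta>\<^sub>1 \<gamma>\<^sub>1 a r * E \<beta>\<^sub>4 0 b s)"
  proof (intro ext, safe)
    fix r s
    define X where "X = \<alpha> * (of_nat a / 4) +
       (\<alpha> * of_int ((\<Sum>j=1..a. (r j)\<^sup>2) + (\<Sum>j=1..b. (s j)\<^sup>2) + (\<Sum>j=1..a. r j)) +
        \<i> * (2 * of_int (\<Sum>j=1..a. r j) * x + 2 * of_int (\<Sum>j=1..b. s j) * y + of_nat a * x)) +
       of_int (half_weight a b (r, s)) * \<i> * (of_real pi + 2 * w)"
    have "F w (r, s) = exp X"
      unfolding F_def R14_term_def qpow_def X_def \<alpha>_def exp_add by (simp add: mult_ac)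
    \<comment> \<open>\<open>half_weight\<close> contributes + i pi a/2 to the exponent, whereas a
      copies of \<open>\<gamma>\<^sub>1\<close> contribute - i pi a/2. With a = 2c the difference is
      a period of exp.\<close>
    also have "exp (2 * of_nat c * of_real pi * \<i> :: complex) = 1"
      by (auto simp: exp_eq_1 intro!: exI[of _ "int c"])
    hence "exp X = exp (X - 2 * of_nat c * of_real pi * \<i>)"
      by (simp add: exp_diff)
    also have "X - 2 * of_nat c * of_real pi * \<i> =
        (\<alpha> * of_int (\<Sum>j=1..a. (r j)\<^sup>2) + \<beta>\<^sub>1 * of_int (\<Sum>j=1..a. r j) + of_nat a * \<gamma>\<^sub>1) +
        (\<alpha> * of_int (\<Sum>j=1..b. (s j)\<^sup>2) + \<beta>\<^sub>4 * of_int (\<Sum>j=1..b. s j) + of_nat b * 0)"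
      unfolding half_weight_def case_prod_conv X_def \<beta>\<^sub>1_def \<gamma>\<^sub>1_def \<beta>\<^sub>4_def of_int_add
      by (simp add: c algebra_simps)
    finally show "F w (r, s) = E \<beta>\<^sub>1 \<gamma>\<^sub>1 a r * E \<beta>\<^sub>4 0 b s"
      unfolding E_def exp_add by (simp add: mult_ac)
  qed
  have E: "E \<beta> \<gamma> a abs_summable_on ({1..a} \<rightarrow>\<^sub>E UNIV)" for \<beta> \<gamma> a
    unfolding E_def by (rule abs_summable_exp_quadratic_tuple[OF \<alpha>])
  have E_infsum: "infsum (E \<beta> \<gamma> a) ({1..a} \<rightarrow>\<^sub>E UNIV) =
      (\<Sum>\<^sub>\<infinity>n::int. exp (\<alpha> * of_int n ^ 2 + \<beta> * of_int n + \<gamma>)) ^ a" for \<beta> \<gamma> a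
    unfolding E_def by (rule infsum_exp_quadratic_tuple[OF \<alpha>])
  show "F w abs_summable_on tuples a b"
    unfolding F by (intro abs_summable_on_Times_mult E)
  have "infsum (F w) (tuples a b) =
      infsum (E \<beta>\<^sub>1 \<gamma>\<^sub>1 a) ({1..a} \<rightarrow>\<^sub>E UNIV) * infsum (E \<beta>\<^sub>4 0 b) ({1..b} \<rightarrow>\<^sub>E UNIV)"
    unfolding F by (intro infsum_Times_mult E)
  thus "theta1 (w + x) \<tau> ^ a * theta4 (w + y) \<tau> ^ b = infsum (F w) (tuples a b)"
    unfolding E_infsum theta1_exp theta4_exp \<beta>\<^sub>1_def \<gamma>\<^sub>1_def \<beta>\<^sub>4_def \<alpha>_def
    by (rule sym)
qed

text \<open>The part of the q-exponent linear in c is c(2(R + S) + a), which is 0 on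
  \<open>R14_index\<close>. The other exponent changes by 2c(ax + by) = 0 (times i). Only the
  quadratic part (a + b)c^2 survives.\<close>

lemma R14_term_shift_pair:
  assumes "of_nat a * x + of_nat b * y = 0" and "even a" and u: "u \<in> R14_index a b"
  shows "R14_term a b x y \<tau> (shift_pair a b c u) =
    qpow \<tau> (of_int (int (a + b) * c\<^sup>2)) * R14_term a b x y \<tau> u"
proof -
  obtain r s where rs: "u = (r, s)" by force
  define R S where "R = (\<Sum>j=1..a. r j)" and "S = (\<Sum>j=1..b. s j)"
  have w0: "2 * (R + S) + int a = 0"
    using u by (simp add: R14_index_def rs R_def S_def)
  have "2 * c * R + 2 * c * S + int a * c = c * (2 * (R + S) + int a)"
    by (simp add: algebra_simps)
  hence w: "2 * c * R + 2 * c * S + int a * c = 0" using w0 by simp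
  have 1: "(\<Sum>j=1..a. (r j)\<^sup>2) + 2 * c * R + int a * c\<^sup>2 +
      ((\<Sum>j=1..b. (s j)\<^sup>2) + 2 * c * S + int b * c\<^sup>2) + (R + int a * c)
     = int (a + b) * c\<^sup>2 + ((\<Sum>j=1..a. (r j)\<^sup>2) + (\<Sum>j=1..b. (s j)\<^sup>2) + R)"
    using w by (simp add: algebra_simps)
  have "2 * of_int (R + int a * c) * x + 2 * of_int (S + int b * c) * y + of_nat a * x
     = 2 * of_int R * x + 2 * of_int S * y + of_nat a * x + 2 * of_int c * (of_nat a * x + of_nat b * y)"
    by (simp add: algebra_simps)
  hence 2: "2 * of_int (R + int a * c) * x + 2 * of_int (S + int b * c) * y + of_nat a * x
     = 2 * of_int R * x + 2 * of_int S * y + of_nat a * x" using assms(1) by simp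
  have q: "qpow \<tau> (of_int (i + j)) = qpow \<tau> (of_int i) * qpow \<tau> (of_int j)" for i j
    by (simp add: qpow_def algebra_simps flip: exp_add)
  show ?thesis
    unfolding R14_term_def rs shift_pair_def case_prod_conv sum_shift R_def[symmetric] S_def[symmetric] 1 2
    unfolding q by (simp only: mult.assoc)
qed

section \<open>Filtering, reindexing and factoring the sum\<close>

lemma infsum_finite_sum:
  fixes f :: "'a \<Rightarrow> 'b \<Rightarrow> 'c :: {topological_comm_monoid_add, t2_space}"
  assumes "finite K" "\<And>k. k \<in> K \<Longrightarrow> f k summable_on A"
  shows "(\<Sum>\<^sub>\<infinity>x\<in>A. \<Sum>k\<in>K. f k x) = (\<Sum>k\<in>K. infsum (f k) A)"
proof -
  have "((\<lambda>x. \<Sum>k\<in>K. f k x) has_sum (\<Sum>k\<in>K. infsum (f k) A)) A"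
    using assms by (induction K rule: finite_induct) (auto intro!: has_sum_add)
  thus ?thesis by (rule infsumI)
qed

text \<open>The sign (-1)^(mnp) is kept as an exponential, so that both parities of mn are treated
  at once; the series over p is the common form of \<open>theta3\<close> and
  \<open>theta4\<close>.\<close>

lemma S14_eq_R14_mult_infsum:
  fixes m n a b :: nat and x y \<tau> :: complex
  assumes \<tau>: "Im \<tau> > 0"
    and "m > 0" and "n > 0"
    and n: "a + b = n" and a: "even a"
    and xy: "of_nat a * x + of_nat b * y = 0"
  shows "S14 a b x y m n \<tau> z = R14 a b x y m n \<tau> *
    (\<Sum>\<^sub>\<infinity>p::int. exp (\<i> * of_real pi * of_int (int (m * n) * p)) *
          qpow (of_nat (m\<^sup>2 * n) * \<tau>) (of_int (p\<^sup>2)) *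
          exp (2 * of_int p * \<i> * (of_nat (m * n) * z)))"
proof -
  define N where "N = m * n"
  have N: "N > 0" using assms by (simp add: N_def)
  define Q where "Q = qpow \<tau> (of_nat a / 4)"
  have Q: "Q \<noteq> 0" by (simp add: Q_def qpow_def)
  define B where "B = R14_term a b x y \<tau>"
  define F where "F = (\<lambda>w u. Q * B u * exp (of_int (half_weight a b u) * \<i> * (of_real pi + 2 * w)))"
  define A where "A = (\<lambda>p::int. exp (\<i> * of_real pi * of_int (int N * p)) *
          qpow (of_nat (m\<^sup>2 * n) * \<tau>) (of_int (p\<^sup>2)) *
          exp (2 * of_int p * \<i> * (of_nat N * z)))"
  define t where "t = (\<lambda>k::nat. of_nat k * of_real pi / of_nat N :: complex)"
  have summ: "F w abs_summable_on tuples a b" for w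
    unfolding F_def Q_def B_def by (rule abs_summable_theta_product[OF \<tau> a])
  have prod: "theta1 (w + x) \<tau> ^ a * theta4 (w + y) \<tau> ^ b = infsum (F w) (tuples a b)" for w
    unfolding F_def Q_def B_def by (rule theta_product_eq_infsum[OF \<tau> a])

  \<comment> \<open>On \<open>R14_index\<close> h = 0, so the exponential factor is 1 and
    \<open>F 0\<close> equals \<open>Q * B\<close>; dividing by the nonzero \<open>Q\<close>
    transfers summability.\<close>
  have B_summ: "B abs_summable_on R14_index a b"
  proof -
    have "F 0 abs_summable_on R14_index a b"
      by (rule summable_on_subset_banach[OF summ]) (auto simp: R14_index_altdef a)
    hence "(\<lambda>u. norm (inverse Q) * norm (F 0 u)) summable_on R14_index a b"
      by (rule summable_on_cmult_right)
    also have "?this \<longleftrightarrow> ?thesis"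
      by (intro summable_on_cong)
         (use Q in \<open>auto simp: F_def R14_index_altdef a norm_mult norm_inverse\<close>)
    finally show ?thesis .
  qed
  have A_summ: "A abs_summable_on UNIV"
  proof -
    have *: "A = (\<lambda>p. exp ((of_real pi * \<i> * (of_nat (m\<^sup>2 * n) * \<tau>)) * of_int p ^ 2 +
              (\<i> * of_real pi * of_nat N + 2 * \<i> * of_nat N * z) * of_int p + 0))"
      by (simp add: A_def qpow_def fun_eq_iff algebra_simps flip: exp_add)
    show ?thesis
      unfolding * by (rule abs_summable_exp_quadratic_int) (use assms in simp)
  qed

  have "S14 a b x y m n \<tau> z = (\<Sum>k<N. infsum (F (z + t k)) (tuples a b))"
    unfolding prod[symmetric] S14_def t_def N_def by (simp add: add_ac atLeast0LessThan)
  also have "\<dots> = (\<Sum>\<^sub>\<infinity>u\<in>tuples a b. \<Sum>k<N. F (z + t k) u)"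
    using abs_summable_summable[OF summ] by (intro infsum_finite_sum[symmetric]) auto
  \<comment> \<open>The translate \<open>t k\<close> enters only through exp (2 h i
    \<open>t k\<close>), so the filter applies to each tuple separately.\<close>
  also have "(\<lambda>u. \<Sum>k<N. F (z + t k) u) =
      (\<lambda>u. if int N dvd half_weight a b u then of_nat N * F z u else 0)"
  proof
    fix u
    have "F (z + t k) u = F z u * exp (2 * of_int (half_weight a b u) * \<i> * t k)" for k
      by (simp add: F_def algebra_simps flip: exp_add)
    thus "(\<Sum>k<N. F (z + t k) u) = (if int N dvd half_weight a b u then of_nat N * F z u else 0)"
      using sum_exp_multiples[OF N, of "half_weight a b u"] unfolding t_def
      by (simp flip: sum_distrib_left)
  qed
  also have "infsum \<dots> (tuples a b) =
      (\<Sum>\<^sub>\<infinity>u\<in>{u \<in> tuples a b. int N dvd half_weight a b u}. of_nat N * F z u)"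
    by (rule infsum_cong_neutral) auto
  also have "\<dots> = (\<Sum>\<^sub>\<infinity>v\<in>UNIV \<times> R14_index a b.
      of_nat N * F z ((\<lambda>(p, u). shift_pair a b (int m * p) u) v))"
    using bij_betw_shift_pair[of a m b] assms unfolding N_def
    by (intro infsum_reindex_bij_betw[symmetric]) auto
  \<comment> \<open>After the shift h = mnp, so the exponential depends on p alone, and
    \<open>B\<close> gains q^(n(mp)^2), which is the p^2-th power of the nome of m^2 n \<tau>. The
    variables p and u therefore separate.\<close>
  also have "\<dots> = (\<Sum>\<^sub>\<infinity>(p, u)\<in>UNIV \<times> R14_index a b. A p * (of_nat N * Q * B u))"
  proof (intro infsum_cong, safe)
    fix p :: int and r s
    assume rs: "(r, s) \<in> R14_index a b"
    have h: "half_weight a b (shift_pair a b (int m * p) (r, s)) = int N * p"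
      using rs by (simp add: half_weight_shift R14_index_altdef a N_def n[symmetric])
    have "B (shift_pair a b (int m * p) (r, s)) = qpow \<tau> (of_int (int (a + b) * (int m * p)\<^sup>2)) * B (r, s)"
      unfolding B_def by (rule R14_term_shift_pair) fact+
    also have "qpow \<tau> (of_int (int (a + b) * (int m * p)\<^sup>2)) = qpow (of_nat (m\<^sup>2 * n) * \<tau>) (of_int (p\<^sup>2))"
      unfolding n by (simp add: qpow_def power_mult_distrib mult_ac)
    finally show "of_nat N * F z (shift_pair a b (int m * p) (r, s)) = A p * (of_nat N * Q * B (r, s))"
      unfolding F_def A_def h by (simp add: algebra_simps exp_add)
  qed
  also have "\<dots> = infsum A UNIV * (\<Sum>\<^sub>\<infinity>u\<in>R14_index a b. of_nat N * Q * B u)"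
    using B_summ by (intro infsum_Times_mult A_summ) (auto simp: norm_mult intro!: summable_on_cmult_right)
  also have "(\<Sum>\<^sub>\<infinity>u\<in>R14_index a b. of_nat N * Q * B u) = R14 a b x y m n \<tau>"
    unfolding infsum_cmult_right' by (simp add: R14_def B_def R14_term_def Q_def N_def)
  finally show ?thesis
    unfolding A_def N_def by (simp only: mult.commute)
qed

theorem theorem3p11:
  fixes m n a b :: nat and x y \<tau> :: complex
  assumes "Im \<tau> > 0"
    and "m > 0" and "n > 0"
    and "a + b = n" and "even a"
    and "of_nat a * x + of_nat b * y = 0"
  shows "\<forall>z::complex.
    (even (m * n) \<longrightarrow>
       S14 a b x y m n \<tau> z = R14 a b x y m n \<tau> * theta3 (of_nat (m * n) * z) (of_nat (m\<^sup>2 * n) * \<tau>)) \<and>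
    (odd (m * n) \<longrightarrow>
       S14 a b x y m n \<tau> z = R14 a b x y m n \<tau> * theta4 (of_nat (m * n) * z) (of_nat (m\<^sup>2 * n) * \<tau>))"
proof -
  \<comment> \<open>This is (-1)^(mnp): constantly 1 for even mn, giving \<open>theta3\<close>, and
    (-1)^p for odd mn, giving \<open>theta4\<close>.\<close>
  have "exp (\<i> * of_real pi * of_int (int (m * n) * p)) = (if even (m * n) then 1 else (-1) powi p)" for p
    unfolding minus_one_powi_eq_exp[symmetric] power_int_mult power_int_of_nat
    by (auto simp: uminus_power_if simp del: even_mult_iff)
  thus ?thesis
    unfolding S14_eq_R14_mult_infsum[OF assms] theta3_def theta4_def by simp
qed

end
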